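(* Let $V$ be a finite set of vertices placed at distinct positions around a circle, let $F\subseteq 2^V\setminus\{\emptyset,V\}$ be a crossing family without complementary sets (that is, there is no $U\in F$ with $V\setminus U\in F$), and let $\sigma:V\to\{+,-\}$ be a $\cap\cup$-closed cosigning for $F$. Suppose every set in $F$ forms an interval around the circle. Then there exists an outer-planar set $E$ of arcs, each directed from a negative vertex to a positive vertex, such that every set $U\in F$ receives an incoming arc, i.e. for every $U\in F$ there is $(m,p)\in E$ with $m\notin U$ and $p\in U$.
   Context: A family $F$ of subsets of $V$ is a crossing family if $U\cap W\in F$ and $U\cup W\in F$ for all $U,W\in F$ with $U\cap W\neq\emptyset$ and $U\cup W\neq V$. A $\cap\cup$-closed cosigning of $F$ is a function $\sigma:V\to\{+,-\}$ such that for all $X,Y\in F$ (possibly equal) with $X\cap Y\neq\emptyset$ the set $X\cap Y$ contains a positive element ($\sigma=+$), and for all $X,Y\in F$ (possibly equal) with $X\cup Y\neq V$ the set $V\setminus(X\cup Y)$ contains a negative element ($\sigma=-$). A set forms an interval if its vertices are consecutive in the circular order on $V$. A set of arcs on $V$ is outer-planar if the arcs can all be drawn inside the circle with no two of them crossing (arcs may share endpoints); equivalently, there are no two arcs with four distinct endpoints such that the endpoints of one separate the endpoints of the other in the circular order. *)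

theory Defs
  imports Complex_Main
begin

datatype sign = Plus | Minus

definition crossing_family :: "'a set \<Rightarrow> 'a set set \<Rightarrow> bool" where
  "crossing_family V F \<longleftrightarrow> F \<subseteq> Pow V \<and>
    (\<forall>U\<in>F. \<forall>W\<in>F. U \<inter> W \<noteq> {} \<and> U \<union> W \<noteq> V \<longrightarrow> U \<inter> W \<in> F \<and> U \<union> W \<in> F)"

definition inter_union_closed_cosigning :: "'a set \<Rightarrow> 'a set set \<Rightarrow> ('a \<Rightarrow> sign) \<Rightarrow> bool" where
  "inter_union_closed_cosigning V F \<sigma> \<longleftrightarrow>
    (\<forall>X\<in>F. \<forall>Y\<in>F. X \<inter> Y \<noteq> {} \<longrightarrow> (\<exists>v\<in>X \<inter> Y. \<sigma> v = Plus)) \<and>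
    (\<forall>X\<in>F. \<forall>Y\<in>F. X \<union> Y \<noteq> V \<longrightarrow> (\<exists>v\<in>V - (X \<union> Y). \<sigma> v = Minus))"

text \<open>A placement of V around a circle is given by angles: the vertex v sits at the
  point \<open>cis (\<theta> v)\<close> of the unit circle.\<close>

definition circular_placement :: "'a set \<Rightarrow> ('a \<Rightarrow> real) \<Rightarrow> bool" where
  "circular_placement V \<theta> \<longleftrightarrow> inj_on \<theta> V \<and> \<theta> ` V \<subseteq> {0..<2 * pi}"

text \<open>The circular order: going counterclockwise from a, one meets b strictly before c
  (and a, b, c are at three distinct positions).\<close>

definition ccw :: "('a \<Rightarrow> real) \<Rightarrow> 'a \<Rightarrow> 'a \<Rightarrow> 'a \<Rightarrow> bool" where
  "ccw \<theta> a b c \<longleftrightarrow>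
    \<theta> a < \<theta> b \<and> \<theta> b < \<theta> c \<or> \<theta> b < \<theta> c \<and> \<theta> c < \<theta> a \<or> \<theta> c < \<theta> a \<and> \<theta> a < \<theta> b"

text \<open>The vertices met when walking counterclockwise from a to b, both included. The case
  \<open>a = b\<close> is a singleton; the whole of V arises when b is the predecessor of a.
  The empty set does not count as an interval.\<close>

definition circular_interval :: "'a set \<Rightarrow> ('a \<Rightarrow> real) \<Rightarrow> 'a set \<Rightarrow> bool" where
  "circular_interval V \<theta> U \<longleftrightarrow>
    (\<exists>a\<in>V. \<exists>b\<in>V. U = {v \<in> V. v = a \<or> v = b \<or> ccw \<theta> a v b})"

text \<open>The points a, b cut the circle into two open arcs; they separate c, d if exactly one
  of c, d lies on the open arc going counterclockwise from a to b. This is meant for four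
  distinct vertices, and only used for those.\<close>

definition separates :: "('a \<Rightarrow> real) \<Rightarrow> 'a \<Rightarrow> 'a \<Rightarrow> 'a \<Rightarrow> 'a \<Rightarrow> bool" where
  "separates \<theta> a b c d \<longleftrightarrow> ccw \<theta> a c b \<noteq> ccw \<theta> a d b"

definition outer_planar :: "('a \<Rightarrow> real) \<Rightarrow> ('a \<times> 'a) set \<Rightarrow> bool" where
  "outer_planar \<theta> E \<longleftrightarrow>
    \<not> (\<exists>(a, b)\<in>E. \<exists>(c, d)\<in>E. distinct [a, b, c, d] \<and> separates \<theta> a b c d)"

end

theory Submission
  imports Defs
begin

text \<open>
  Suppose the theorem fails and take a counterexample with as few vertices as possible. The
  hypotheses survive the following reduction (\<open>critical_irreducible\<close>): draw some arcs that no
  later arc can cross, keep only the sets that they leave uncovered, and delete a set \<open>D\<close> of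
  vertices. The uncovered sets still form a crossing family, so what is left is a smaller instance
  provided that a nonempty intersection of two uncovered sets keeps a positive vertex outside \<open>D\<close>
  and, dually, that the vertices missed by two uncovered sets, if any, include a negative one
  outside \<open>D\<close>. In a minimal counterexample every such attempt must fail.

  Let \<open>m\<close> (negative) and \<open>p\<close> (positive) be next to each other on the circle, and draw the arc
  from \<open>m\<close> to \<open>p\<close>. Deleting \<open>p\<close> fails only if two sets share \<open>m\<close> and \<open>p\<close> and no other positive
  vertex; deleting \<open>m\<close> fails only if two sets miss \<open>m\<close> and \<open>p\<close> and no other negative vertex. If
  both fail, uncrossing these four sets shows (\<open>critical_neighbours\<close>) that \<open>{m, p}\<close> is in \<open>F\<close> and
  that two disjoint members \<open>B\<close> and \<open>C\<close> of \<open>F\<close> avoid \<open>m\<close> and \<open>p\<close> and contain all other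
  negative vertices, or that the same holds for the family of complements with the signs exchanged.
  By this duality the first alternative may be assumed.

  Now walk away from \<open>m\<close> in the direction of \<open>p\<close>. The vertex \<open>t\<close> just behind \<open>m\<close> is negative,
  since otherwise the pair \<open>m, t\<close>, which is subject to the same dichotomy, would be incompatible
  with \<open>{m, p}\<close>. Say \<open>t \<in> B\<close>, and choose \<open>C\<close> as small as possible. Because \<open>B\<close> is an interval,
  the walk meets only positive vertices between \<open>m\<close> and the first vertex \<open>q\<close> of \<open>C\<close>, and the
  dichotomy for the pair formed by \<open>q\<close> and its predecessor makes \<open>q\<close> positive as well. Then
  the arc from \<open>m\<close> to \<open>p\<close>, together with the arcs from \<open>t\<close> to \<open>q\<close> and to all positive vertices
  before \<open>q\<close>, permits the deletion of everything from \<open>m\<close> up to but excluding \<open>q\<close>: a failure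
  of the second condition would produce a smaller choice of \<open>C\<close>, and the first one holds anyway
  (\<open>no_straightened_tight_pair\<close>). So there is no counterexample.
\<close>

section \<open>Crossing chords\<close>

definition chords_cross :: "('a \<Rightarrow> real) \<Rightarrow> 'a \<Rightarrow> 'a \<Rightarrow> 'a \<Rightarrow> 'a \<Rightarrow> bool" where
  "chords_cross \<theta> a b c d \<longleftrightarrow> distinct [a, b, c, d] \<and> separates \<theta> a b c d"

text \<open>
  Everything that is claimed about a placement depends only on which chords cross. This freedom is
  what allows the circle to be cut open at any vertex and to be reflected.
\<close>

definition same_crossings :: "'a set \<Rightarrow> ('a \<Rightarrow> real) \<Rightarrow> ('a \<Rightarrow> real) \<Rightarrow> bool" where
  "same_crossings V \<theta> \<theta>' \<longleftrightarrow>
    (\<forall>a\<in>V. \<forall>b\<in>V. \<forall>c\<in>V. \<forall>d\<in>V. chords_cross \<theta>' a b c d \<longleftrightarrow> chords_cross \<theta> a b c d)"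

text \<open>
  A substitute for being an interval that passes to the trace on a subset of the vertices and is
  invariant under complementation.
\<close>

definition chord_convex :: "'a set \<Rightarrow> ('a \<Rightarrow> real) \<Rightarrow> 'a set \<Rightarrow> bool" where
  "chord_convex V \<theta> U \<longleftrightarrow>
    (\<forall>a\<in>U. \<forall>b\<in>U. \<forall>c\<in>V - U. \<forall>d\<in>V - U. \<not> chords_cross \<theta> a b c d)"

definition neighbours :: "'a set \<Rightarrow> ('a \<Rightarrow> real) \<Rightarrow> 'a \<Rightarrow> 'a \<Rightarrow> bool" where
  "neighbours V \<theta> a b \<longleftrightarrow>
    a \<in> V \<and> b \<in> V \<and> a \<noteq> b \<and> (\<forall>c\<in>V. \<forall>d\<in>V. \<not> chords_cross \<theta> a b c d)"

lemma outer_planar_iff: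
  "outer_planar \<theta> E \<longleftrightarrow> (\<forall>(a, b)\<in>E. \<forall>(c, d)\<in>E. \<not> chords_cross \<theta> a b c d)"
  by (auto simp: outer_planar_def chords_cross_def)

text \<open>
  After cutting the circle open, crossing says that exactly one endpoint of the second chord lies
  between the endpoints of the first. This description makes the symmetries of crossing evident,
  and it hides the cyclic case distinction of \<open>ccw\<close>.
\<close>

lemma chords_cross_iff_less:
  assumes "inj_on \<theta> V" "a \<in> V" "b \<in> V" "c \<in> V" "d \<in> V"
  shows "chords_cross \<theta> a b c d \<longleftrightarrow>
    a \<noteq> b \<and> a \<noteq> c \<and> a \<noteq> d \<and> b \<noteq> c \<and> b \<noteq> d \<and> c \<noteq> d \<and>
    (min (\<theta> a) (\<theta> b) < \<theta> c \<and> \<theta> c < max (\<theta> a) (\<theta> b)) \<noteq>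
    (min (\<theta> a) (\<theta> b) < \<theta> d \<and> \<theta> d < max (\<theta> a) (\<theta> b))"
proof (cases "distinct [a, b, c, d]")
  case True
  then have ne: "\<theta> a \<noteq> \<theta> b" "\<theta> a \<noteq> \<theta> c" "\<theta> a \<noteq> \<theta> d" "\<theta> b \<noteq> \<theta> c" "\<theta> b \<noteq> \<theta> d"
    using assms by (auto simp: inj_on_eq_iff)
  show ?thesis
  proof (cases "\<theta> a < \<theta> b")
    case less: True
    have "ccw \<theta> a x b \<longleftrightarrow> min (\<theta> a) (\<theta> b) < \<theta> x \<and> \<theta> x < max (\<theta> a) (\<theta> b)" for x
      using less by (auto simp: ccw_def)
    then show ?thesis using True by (auto simp: chords_cross_def separates_def)
  next
    case False
    then have less: "\<theta> b < \<theta> a" using ne by simp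
    have "ccw \<theta> a x b \<longleftrightarrow> \<not> (min (\<theta> a) (\<theta> b) < \<theta> x \<and> \<theta> x < max (\<theta> a) (\<theta> b))"
      if "\<theta> x \<noteq> \<theta> a" "\<theta> x \<noteq> \<theta> b" for x
      using less that by (auto simp: ccw_def)
    then show ?thesis using True ne by (auto simp: chords_cross_def separates_def)
  qed
qed (auto simp: chords_cross_def)

lemma chords_cross_swap:
  assumes "inj_on \<theta> V" "a \<in> V" "b \<in> V" "c \<in> V" "d \<in> V"
  shows "chords_cross \<theta> a b c d \<longleftrightarrow> chords_cross \<theta> b a c d"
  unfolding chords_cross_iff_less[OF assms] chords_cross_iff_less[OF assms(1,3,2,4,5)]
    min.commute[of "\<theta> b"] max.commute[of "\<theta> b"]
  by blast

lemma interlaced_commute: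
  fixes x y z w :: real
  assumes "x \<noteq> y" "x \<noteq> z" "x \<noteq> w" "y \<noteq> z" "y \<noteq> w" "z \<noteq> w"
  shows "((min x y < z \<and> z < max x y) \<noteq> (min x y < w \<and> w < max x y)) \<longleftrightarrow>
         ((min z w < x \<and> x < max z w) \<noteq> (min z w < y \<and> y < max z w))"
  using assms unfolding min_def max_def by (smt (verit))

lemma chords_cross_commute:
  assumes "inj_on \<theta> V" "a \<in> V" "b \<in> V" "c \<in> V" "d \<in> V"
  shows "chords_cross \<theta> a b c d \<longleftrightarrow> chords_cross \<theta> c d a b"
proof (cases "distinct [a, b, c, d]")
  case True
  then have "\<theta> a \<noteq> \<theta> b" "\<theta> a \<noteq> \<theta> c" "\<theta> a \<noteq> \<theta> d" "\<theta> b \<noteq> \<theta> c" "\<theta> b \<noteq> \<theta> d" "\<theta> c \<noteq> \<theta> d"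
    using assms by (auto simp: inj_on_eq_iff)
  from interlaced_commute[OF this] show ?thesis
    unfolding chords_cross_iff_less[OF assms] chords_cross_iff_less[OF assms(1,4,5,2,3)]
    by blast
qed (auto simp: chords_cross_def)

lemma outer_planar_Un:
  assumes "inj_on \<theta> V" "E \<subseteq> V \<times> V" "E' \<subseteq> V \<times> V"
    and "outer_planar \<theta> E" "outer_planar \<theta> E'"
    and "\<And>a b c d. (a, b) \<in> E \<Longrightarrow> (c, d) \<in> E' \<Longrightarrow> \<not> chords_cross \<theta> a b c d"
  shows "outer_planar \<theta> (E \<union> E')"
proof -
  have "\<not> chords_cross \<theta> c d a b" if "(a, b) \<in> E" "(c, d) \<in> E'" for a b c d
    using assms(6)[OF that] chords_cross_commute[OF assms(1), of a b c d] that assms(2,3) by auto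
  then have "\<not> chords_cross \<theta> a b c d" if "(a, b) \<in> E \<union> E'" "(c, d) \<in> E \<union> E'" for a b c d
    using that assms(4-6) unfolding outer_planar_iff by (elim UnE) auto
  then show ?thesis unfolding outer_planar_iff by auto
qed

text \<open>
  The constant \<open>K\<close> stands for a full turn. It only has to exceed the spread of the angles, which
  need not lie in a range of length \<open>2 * pi\<close> once a placement has been rotated or reflected.
\<close>

definition rotate_to :: "real \<Rightarrow> ('a \<Rightarrow> real) \<Rightarrow> 'a \<Rightarrow> 'a \<Rightarrow> real" where
  "rotate_to K \<theta> m v = (if \<theta> v < \<theta> m then \<theta> v + K else \<theta> v)"

lemma finite_spread_bound:
  fixes \<theta> :: "'a \<Rightarrow> real"
  assumes "finite V"
  shows "\<exists>K. \<forall>u\<in>V. \<forall>v\<in>V. \<theta> u - \<theta> v < K"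
proof -
  have "\<theta> u - \<theta> v < Max (\<theta> ` V) - Min (\<theta> ` V) + 1" if "u \<in> V" "v \<in> V" for u v
  proof -
    have "\<theta> u \<le> Max (\<theta> ` V)" "Min (\<theta> ` V) \<le> \<theta> v" using assms that by simp_all
    then show ?thesis by simp
  qed
  then show ?thesis by blast
qed

lemma rotate_to_ccw:
  assumes K: "\<forall>u\<in>V. \<forall>v\<in>V. \<theta> u - \<theta> v < K"
    and "m \<in> V" "a \<in> V" "b \<in> V" "c \<in> V"
  shows "ccw (rotate_to K \<theta> m) a b c \<longleftrightarrow> ccw \<theta> a b c"
proof -
  have "\<theta> x < \<theta> y + K" if "x \<in> V" "y \<in> V" for x y using K that by (simp add: algebra_simps)
  then have "\<theta> a < \<theta> b + K" "\<theta> a < \<theta> c + K" "\<theta> b < \<theta> a + K" "\<theta> b < \<theta> c + K" "\<theta> c < \<theta> a + K" "\<theta> c < \<theta> b + K"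
    using assms by auto
  then show ?thesis
    unfolding ccw_def rotate_to_def
    by (cases "\<theta> a < \<theta> m"; cases "\<theta> b < \<theta> m"; cases "\<theta> c < \<theta> m") auto
qed

lemma rotate_to_least:
  assumes K: "\<forall>u\<in>V. \<forall>v\<in>V. \<theta> u - \<theta> v < K"
    and "inj_on \<theta> V" "m \<in> V"
  shows "inj_on (rotate_to K \<theta> m) V"
    and "\<And>v. v \<in> V \<Longrightarrow> v \<noteq> m \<Longrightarrow> rotate_to K \<theta> m m < rotate_to K \<theta> m v"
proof -
  have *: "\<theta> x < \<theta> y + K" if "x \<in> V" "y \<in> V" for x y using K that by (simp add: algebra_simps)
  show "inj_on (rotate_to K \<theta> m) V"
    using assms(2) * unfolding inj_on_def rotate_to_def
    by (smt (verit))
  show "rotate_to K \<theta> m m < rotate_to K \<theta> m v" if "v \<in> V" "v \<noteq> m" for v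
    using that assms(2,3) *[OF assms(3) that(1)] unfolding rotate_to_def
    by (auto simp: inj_on_def) (smt (verit))
qed

section \<open>Cosigned crossing families\<close>

fun flip :: "sign \<Rightarrow> sign" where
  "flip Plus = Minus"
| "flip Minus = Plus"

lemma flip_eq_iff [simp]: "flip s = Plus \<longleftrightarrow> s = Minus" "flip s = Minus \<longleftrightarrow> s = Plus"
  by (cases s; simp)+

lemma not_Plus_iff: "s \<noteq> Plus \<longleftrightarrow> s = Minus"
  by (cases s) auto

locale cosigned_family =
  fixes V :: "'a set" and F :: "'a set set" and \<sigma> :: "'a \<Rightarrow> sign"
  assumes finite_V: "finite V"
    and proper: "F \<subseteq> Pow V - {{}, V}"
    and crossing: "crossing_family V F"
    and no_complements: "\<not> (\<exists>U\<in>F. V - U \<in> F)"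
    and cosigning: "inter_union_closed_cosigning V F \<sigma>"
begin

lemma subset_V: "X \<in> F \<Longrightarrow> X \<subseteq> V"
  using proper by auto

lemma nonempty: "X \<in> F \<Longrightarrow> X \<noteq> {}"
  using proper by auto

lemma not_V: "X \<in> F \<Longrightarrow> X \<noteq> V"
  using proper by auto

lemma plus_in_inter:
  assumes "X \<in> F" "Y \<in> F" "X \<inter> Y \<noteq> {}"
  obtains v where "v \<in> X" "v \<in> Y" "v \<in> V" "\<sigma> v = Plus"
proof -
  have "\<exists>v\<in>X \<inter> Y. \<sigma> v = Plus"
    using cosigning assms unfolding inter_union_closed_cosigning_def by simp
  then show ?thesis using that subset_V[OF assms(1)] by auto
qed

lemma minus_outside_union:
  assumes "X \<in> F" "Y \<in> F" "X \<union> Y \<noteq> V"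
  obtains v where "v \<in> V" "v \<notin> X" "v \<notin> Y" "\<sigma> v = Minus"
proof -
  have "\<exists>v\<in>V - (X \<union> Y). \<sigma> v = Minus"
    using cosigning assms unfolding inter_union_closed_cosigning_def by simp
  then show ?thesis using that by auto
qed

lemma crossing_inter:
  "X \<in> F \<Longrightarrow> Y \<in> F \<Longrightarrow> X \<inter> Y \<noteq> {} \<Longrightarrow> X \<union> Y \<noteq> V \<Longrightarrow> X \<inter> Y \<in> F"
  using crossing unfolding crossing_family_def by blast

lemma crossing_union:
  "X \<in> F \<Longrightarrow> Y \<in> F \<Longrightarrow> X \<inter> Y \<noteq> {} \<Longrightarrow> X \<union> Y \<noteq> V \<Longrightarrow> X \<union> Y \<in> F"
  using crossing unfolding crossing_family_def by blast

lemma not_complementary: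
  assumes "X \<in> F" "Y \<in> F" "X \<inter> Y = {}" "X \<union> Y = V"
  shows False
proof -
  have "V - X = Y" using assms by blast
  then show False using no_complements assms by blast
qed

lemma disjoint_misses_minus:
  assumes "X \<in> F" "Y \<in> F" "X \<inter> Y = {}"
  obtains v where "v \<in> V" "v \<notin> X" "v \<notin> Y" "\<sigma> v = Minus"
proof -
  have "X \<union> Y \<noteq> V" using not_complementary[OF assms] by auto
  with minus_outside_union[OF assms(1,2)] that show ?thesis by metis
qed

text \<open>
  Complementation exchanges intersections with complements of unions, so the two halves of the
  cosigning condition trade places when the signs are exchanged.
\<close>

lemma dual: "cosigned_family V ((-) V ` F) (flip \<circ> \<sigma>)"
proof
  show "finite V" by (rule finite_V)
  show "(-) V ` F \<subseteq> Pow V - {{}, V}"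
    using proper by auto
  show "crossing_family V ((-) V ` F)"
    unfolding crossing_family_def
  proof (intro conjI ballI impI)
    fix U W assume "U \<in> (-) V ` F" "W \<in> (-) V ` F" and *: "U \<inter> W \<noteq> {} \<and> U \<union> W \<noteq> V"
    then obtain X Y where XY: "X \<in> F" "Y \<in> F" "U = V - X" "W = V - Y" by blast
    then have "X \<union> Y \<noteq> V" "X \<inter> Y \<noteq> {}" using * subset_V[of X] subset_V[of Y] by blast+
    then have "X \<inter> Y \<in> F" "X \<union> Y \<in> F" using XY crossing_inter crossing_union by auto
    then show "U \<inter> W \<in> (-) V ` F" "U \<union> W \<in> (-) V ` F"
      unfolding XY by (auto simp: Diff_Un[symmetric] Diff_Int[symmetric])
  qed auto
  show "\<not> (\<exists>U\<in>(-) V ` F. V - U \<in> (-) V ` F)"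
  proof
    assume "\<exists>U\<in>(-) V ` F. V - U \<in> (-) V ` F"
    then obtain X Y where XY: "X \<in> F" "Y \<in> F" "V - (V - X) = V - Y" by blast
    then show False using not_complementary[of X Y] subset_V[of X] subset_V[of Y] by blast
  qed
  show "inter_union_closed_cosigning V ((-) V ` F) (flip \<circ> \<sigma>)"
    unfolding inter_union_closed_cosigning_def
  proof (intro conjI ballI impI)
    fix U W assume "U \<in> (-) V ` F" "W \<in> (-) V ` F"
    then obtain X Y where XY: "X \<in> F" "Y \<in> F" "U = V - X" "W = V - Y" by blast
    { assume "U \<inter> W \<noteq> {}"
      then have "X \<union> Y \<noteq> V" using XY by blast
      from minus_outside_union[OF XY(1,2) this] obtain v where "v \<in> V" "v \<notin> X" "v \<notin> Y" "\<sigma> v = Minus" .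
      then show "\<exists>v\<in>U \<inter> W. (flip \<circ> \<sigma>) v = Plus" using XY by auto }
    { assume "U \<union> W \<noteq> V"
      then have "X \<inter> Y \<noteq> {}" using XY subset_V[of X] by blast
      from plus_in_inter[OF XY(1,2) this] obtain v where "v \<in> X" "v \<in> Y" "v \<in> V" "\<sigma> v = Plus" .
      then show "\<exists>v\<in>V - (U \<union> W). (flip \<circ> \<sigma>) v = Minus" using XY by auto }
  qed
qed

end

text \<open>
  The obstruction to deleting one of two neighbours \<open>m\<close> and \<open>p\<close> after drawing the arc from \<open>m\<close> to
  \<open>p\<close>: some arc must enter \<open>p\<close> from elsewhere, and deleting \<open>m\<close> would leave no negative vertex
  outside \<open>B \<union> C\<close>.
\<close>

definition tight_pair :: "'a set \<Rightarrow> 'a set set \<Rightarrow> ('a \<Rightarrow> sign) \<Rightarrow> 'a \<Rightarrow> 'a \<Rightarrow> bool" where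
  "tight_pair V F \<sigma> m p \<longleftrightarrow> {m, p} \<in> F \<and>
    (\<exists>B\<in>F. \<exists>C\<in>F. B \<inter> C = {} \<and> m \<notin> B \<union> C \<and> p \<notin> B \<union> C \<and>
      (\<forall>v\<in>V. \<sigma> v = Minus \<longrightarrow> v = m \<or> v \<in> B \<union> C))"

context cosigned_family
begin

text \<open>
  \<open>B\<close> and \<open>C\<close> must be disjoint: their union would otherwise be a member of \<open>F\<close> that, together with
  the disjoint set \<open>A\<close>, contains every negative vertex. Any further element of \<open>A\<close> would be a
  negative vertex in \<open>B\<close> or \<open>C\<close>, but a member of \<open>F\<close> that avoids \<open>p\<close> shares no positive
  vertex with \<open>A\<close> and hence is disjoint from it.
\<close>

lemma tight_pair_if_inter_in_F:
  assumes A: "A \<in> F" "m \<in> A" "p \<in> A" "\<And>v. v \<in> A \<Longrightarrow> \<sigma> v = Plus \<Longrightarrow> v = p"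
    and BC: "B \<in> F" "C \<in> F" "m \<notin> B" "m \<notin> C" "p \<notin> B" "p \<notin> C"
    and cover: "\<And>v. v \<in> V \<Longrightarrow> \<sigma> v = Minus \<Longrightarrow> v = m \<or> v \<in> B \<or> v \<in> C"
  shows "tight_pair V F \<sigma> m p"
proof -
  have disj: "A \<inter> X = {}" if "X \<in> F" "p \<notin> X" for X
    using plus_in_inter[OF A(1) that(1)] A(4) that(2) by metis
  have "B \<inter> C = {}"
  proof (rule ccontr)
    assume "B \<inter> C \<noteq> {}"
    moreover have "B \<union> C \<noteq> V" using BC A subset_V by blast
    ultimately have "B \<union> C \<in> F" using BC crossing_union by blast
    moreover from this have "A \<inter> (B \<union> C) = {}" using disj BC by blast
    ultimately obtain v where "v \<in> V" "v \<notin> A" "v \<notin> B \<union> C" "\<sigma> v = Minus"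
      using disjoint_misses_minus A(1) by metis
    then show False using cover A by blast
  qed
  moreover have "v = m \<or> v = p" if "v \<in> A" for v
    using that A(4)[OF that] cover[of v] disj[of B] disj[of C] BC subset_V[OF A(1)]
    by (cases "\<sigma> v") auto
  then have "A = {m, p}" using A by blast
  ultimately show ?thesis unfolding tight_pair_def using A BC cover by blast
qed

text \<open>
  The next two lemmas exclude the case in which neither pair of obstructing sets can be uncrossed:
  \<open>X\<close> and \<open>Y\<close> cover \<open>V\<close>, while \<open>P\<close> and \<open>Q\<close> are disjoint. The four sets then determine each other
  so tightly that two complementary members of \<open>F\<close> appear. If \<open>P\<close> lies in the complement of \<open>X\<close>,
  these are \<open>Q \<inter> X\<close> and \<open>Y\<close>.
\<close>

lemma no_doubly_covering_quadruple_nested: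
  assumes F: "X \<in> F" "Y \<in> F" "P \<in> F" "Q \<in> F"
    and XY: "X \<union> Y = V" "m \<in> Y"
      "\<And>v. v \<in> X \<Longrightarrow> v \<in> Y \<Longrightarrow> \<sigma> v = Plus \<Longrightarrow> v = p"
    and PQ: "P \<inter> Q = {}" "p \<notin> Q"
      "\<And>v. v \<in> V \<Longrightarrow> \<sigma> v = Minus \<Longrightarrow> v = m \<or> v \<in> P \<or> v \<in> Q"
    and nested: "P \<inter> X = {}"
  shows False
proof -
  have minus: "\<exists>v. v \<notin> R \<and> v \<notin> S \<and> (v \<in> P \<or> v \<in> Q)"
    if RS: "R \<in> F" "S \<in> F" "R \<union> S \<noteq> V" "m \<in> R" for R S
  proof -
    obtain v where "v \<in> V" "v \<notin> R" "v \<notin> S" "\<sigma> v = Minus"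
      using minus_outside_union[OF RS(1-3)] .
    then show ?thesis using PQ(3) RS(4) by auto
  qed
  have PY: "P \<subseteq> Y" using nested XY(1) subset_V[OF F(3)] by blast
  have QY: "\<not> Q \<subseteq> Y"
    using minus[OF F(2,2)] XY(2) PY not_V[OF F(2)] by auto
  have YQ: "Y \<union> Q = V"
    using minus[OF F(2,4) _ XY(2)] PY by blast
  have "Q \<inter> X \<noteq> {}" using QY XY(1) subset_V[OF F(4)] by blast
  moreover have "Q \<union> X \<noteq> V" using nested PQ(1) nonempty[OF F(3)] subset_V[OF F(3)] by blast
  ultimately have QX: "Q \<inter> X \<in> F" using crossing_inter[OF F(4,1)] by simp
  have "(Q \<inter> X) \<inter> Y = {}"
  proof (rule ccontr)
    assume "(Q \<inter> X) \<inter> Y \<noteq> {}"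
    then obtain v where "v \<in> Q \<inter> X" "v \<in> Y" "\<sigma> v = Plus"
      using plus_in_inter[OF QX F(2)] by metis
    then show False using XY(3)[of v] PQ(2) by auto
  qed
  moreover have "(Q \<inter> X) \<union> Y = V" using YQ XY(1) by blast
  ultimately show False using not_complementary[OF QX F(2)] by simp
qed

text \<open>
  By the previous lemma \<open>P\<close> and \<open>Q\<close> may be assumed to meet both \<open>X\<close> and \<open>Y\<close>; now \<open>Q \<union> X\<close> and
  \<open>P \<inter> Y\<close> are complementary.
\<close>

lemma no_doubly_covering_quadruple:
  assumes F: "X \<in> F" "Y \<in> F" "P \<in> F" "Q \<in> F"
    and XY: "X \<union> Y = V" "m \<in> X" "m \<in> Y"
      "\<And>v. v \<in> X \<Longrightarrow> v \<in> Y \<Longrightarrow> \<sigma> v = Plus \<Longrightarrow> v = p"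
    and PQ: "P \<inter> Q = {}" "p \<notin> P" "p \<notin> Q"
      "\<And>v. v \<in> V \<Longrightarrow> \<sigma> v = Minus \<Longrightarrow> v = m \<or> v \<in> P \<or> v \<in> Q"
  shows False
proof -
  have YX: "Y \<union> X = V" and QP: "Q \<inter> P = {}" using XY(1) PQ(1) by auto
  have ne: "P \<inter> X \<noteq> {}" "P \<inter> Y \<noteq> {}" "Q \<inter> X \<noteq> {}" "Q \<inter> Y \<noteq> {}"
    using no_doubly_covering_quadruple_nested[OF F(1,2,3,4) XY(1,3,4) PQ(1,3)]
      no_doubly_covering_quadruple_nested[OF F(2,1,3,4) YX XY(2) XY(4) PQ(1,3)]
      no_doubly_covering_quadruple_nested[OF F(1,2,4,3) XY(1,3,4) QP PQ(2)]
      no_doubly_covering_quadruple_nested[OF F(2,1,4,3) YX XY(2) XY(4) QP PQ(2)]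
      PQ(4) by blast+
  \<comment> \<open>A member of \<open>F\<close> that avoids \<open>p\<close> and meets one of \<open>X\<close> and \<open>Y\<close> sticks out of the other one,
    because the positive vertex that they share lies outside the other one.\<close>
  have not_sub: "\<not> R \<subseteq> Y" if R: "R \<in> F" "R \<inter> X \<noteq> {}" "p \<notin> R" for R
  proof
    assume "R \<subseteq> Y"
    obtain v where "v \<in> R" "v \<in> X" "\<sigma> v = Plus" using plus_in_inter[OF R(1) F(1) R(2)] .
    then show False using XY(4)[of v] \<open>R \<subseteq> Y\<close> R(3) by auto
  qed
  have not_sub': "\<not> R \<subseteq> X" if R: "R \<in> F" "R \<inter> Y \<noteq> {}" "p \<notin> R" for R
  proof
    assume "R \<subseteq> X"
    obtain v where "v \<in> R" "v \<in> Y" "\<sigma> v = Plus" using plus_in_inter[OF R(1) F(2) R(2)] .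
    then show False using XY(4)[of v] \<open>R \<subseteq> X\<close> R(3) by auto
  qed
  have PnX: "\<not> P \<subseteq> X" and QnX: "\<not> Q \<subseteq> X" and QnY: "\<not> Q \<subseteq> Y"
    using not_sub[of Q] not_sub'[of P] not_sub'[of Q] F ne PQ by auto
  have neV: "P \<union> X \<noteq> V" "P \<union> Y \<noteq> V" "Q \<union> X \<noteq> V"
    using PnX QnX QnY PQ(1) subset_V[OF F(3)] subset_V[OF F(4)] by blast+
  have PY: "P \<inter> Y \<in> F" and PX: "P \<union> X \<in> F" and QX: "Q \<union> X \<in> F"
    using crossing_inter[OF F(3,2)] crossing_union[OF F(3,1)] crossing_union[OF F(4,1)] ne neV
    by simp_all
  have "P \<union> X \<union> Q = V"
  proof (rule ccontr)
    assume "P \<union> X \<union> Q \<noteq> V"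
    then obtain v where "v \<in> V" "v \<notin> P \<union> X" "v \<notin> Q" "\<sigma> v = Minus"
      using minus_outside_union[OF PX F(4)] by metis
    then show False using PQ(4)[of v] XY(2) by auto
  qed
  then have "(Q \<union> X) \<union> (P \<inter> Y) = V" using XY(1) by blast
  moreover have "(Q \<union> X) \<inter> (P \<inter> Y) = {}"
  proof (rule ccontr)
    assume "(Q \<union> X) \<inter> (P \<inter> Y) \<noteq> {}"
    then have "X \<inter> (P \<inter> Y) \<noteq> {}" using PQ(1) by blast
    then obtain v where "v \<in> X" "v \<in> P \<inter> Y" "\<sigma> v = Plus"
      using plus_in_inter[OF F(1) PY] by metis
    then show False using XY(4)[of v] PQ(2) by auto
  qed
  ultimately show False using not_complementary[OF QX PY] by simp
qed

end

section \<open>Minimal counterexamples\<close>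

definition interval_instance ::
    "'a set \<Rightarrow> ('a \<Rightarrow> real) \<Rightarrow> 'a set set \<Rightarrow> ('a \<Rightarrow> sign) \<Rightarrow> bool" where
  "interval_instance V \<theta> F \<sigma> \<longleftrightarrow>
    cosigned_family V F \<sigma> \<and> inj_on \<theta> V \<and> (\<forall>U\<in>F. chord_convex V \<theta> U)"

definition coverable ::
    "'a set \<Rightarrow> ('a \<Rightarrow> real) \<Rightarrow> 'a set set \<Rightarrow> ('a \<Rightarrow> sign) \<Rightarrow> bool" where
  "coverable V \<theta> F \<sigma> \<longleftrightarrow>
    (\<exists>E. E \<subseteq> V \<times> V \<and> outer_planar \<theta> E \<and>
      (\<forall>(m, p)\<in>E. \<sigma> m = Minus \<and> \<sigma> p = Plus) \<and>
      (\<forall>U\<in>F. \<exists>(m, p)\<in>E. m \<notin> U \<and> p \<in> U))"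

text \<open>
  Minimality ranges over all placements, families and signs on fewer vertices, so that being a
  minimal counterexample is preserved by rotation, reflection and complementation.
\<close>

definition critical ::
    "'a set \<Rightarrow> ('a \<Rightarrow> real) \<Rightarrow> 'a set set \<Rightarrow> ('a \<Rightarrow> sign) \<Rightarrow> bool" where
  "critical V \<theta> F \<sigma> \<longleftrightarrow>
    interval_instance V \<theta> F \<sigma> \<and> \<not> coverable V \<theta> F \<sigma> \<and>
    (\<forall>V' (\<theta>' :: 'a \<Rightarrow> real) F' \<sigma>'.
      card V' < card V \<longrightarrow> interval_instance V' \<theta>' F' \<sigma>' \<longrightarrow> coverable V' \<theta>' F' \<sigma>')"

lemma criticalD:
  assumes "critical V \<theta> F \<sigma>"
  shows "cosigned_family V F \<sigma>" "inj_on \<theta> V" "\<And>U. U \<in> F \<Longrightarrow> chord_convex V \<theta> U"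
    "\<not> coverable V \<theta> F \<sigma>"
  using assms by (auto simp: critical_def interval_instance_def)

lemma critical_same_crossings:
  assumes "critical V \<theta> F \<sigma>" "same_crossings V \<theta> \<theta>'" "inj_on \<theta>' V"
  shows "critical V \<theta>' F \<sigma>"
proof -
  interpret cosigned_family V F \<sigma> using criticalD(1)[OF assms(1)] .
  have cross: "chords_cross \<theta>' a b c d \<longleftrightarrow> chords_cross \<theta> a b c d"
    if "a \<in> V" "b \<in> V" "c \<in> V" "d \<in> V" for a b c d
    using assms(2) that unfolding same_crossings_def by blast
  have "chord_convex V \<theta>' U" if U: "U \<in> F" for U
    using criticalD(3)[OF assms(1) U] subset_V[OF U] unfolding chord_convex_def
    by (simp add: cross subset_iff)
  moreover have "outer_planar \<theta> E" if E: "E \<subseteq> V \<times> V" "outer_planar \<theta>' E" for E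
    unfolding outer_planar_iff
  proof clarify
    fix a b c d assume "(a, b) \<in> E" "(c, d) \<in> E" "chords_cross \<theta> a b c d"
    moreover from this have "chords_cross \<theta>' a b c d"
      using cross[of a b c d] E(1) by auto
    ultimately show False using E(2) unfolding outer_planar_iff by auto
  qed
  then have "coverable V \<theta>' F \<sigma> \<Longrightarrow> coverable V \<theta> F \<sigma>"
    unfolding coverable_def by meson
  ultimately show ?thesis
    using assms(1,3) unfolding critical_def interval_instance_def by meson
qed

lemma critical_dual:
  assumes "critical V \<theta> F \<sigma>"
  shows "critical V \<theta> ((-) V ` F) (flip \<circ> \<sigma>)"
proof -
  interpret cosigned_family V F \<sigma> using criticalD(1)[OF assms] .
  have "chord_convex V \<theta> (V - U)" if U: "U \<in> F" for U
  proof -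
    have "\<not> chords_cross \<theta> a b c d"
      if "a \<in> V - U" "b \<in> V - U" "c \<in> U" "d \<in> U" for a b c d
      using criticalD(3)[OF assms U] chords_cross_commute[OF criticalD(2)[OF assms], of a b c d]
        that subset_V[OF U] unfolding chord_convex_def by (meson Diff_iff subsetD)
    then show ?thesis using subset_V[OF U] unfolding chord_convex_def by auto
  qed
  then have "interval_instance V \<theta> ((-) V ` F) (flip \<circ> \<sigma>)"
    unfolding interval_instance_def using dual criticalD(2)[OF assms] by auto
  moreover have "coverable V \<theta> F \<sigma>" if cov: "coverable V \<theta> ((-) V ` F) (flip \<circ> \<sigma>)"
  proof -
    obtain E where E: "E \<subseteq> V \<times> V" "outer_planar \<theta> E"
        "\<And>a b. (a, b) \<in> E \<Longrightarrow> \<sigma> a = Plus \<and> \<sigma> b = Minus"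
        "\<And>U. U \<in> F \<Longrightarrow> \<exists>a b. (a, b) \<in> E \<and> a \<notin> V - U \<and> b \<in> V - U"
      using cov unfolding coverable_def by fastforce
    have "outer_planar \<theta> (E\<inverse>)"
      unfolding outer_planar_iff
    proof clarify
      fix a b c d assume *: "(b, a) \<in> E" "(d, c) \<in> E" "chords_cross \<theta> a b c d"
      have V: "a \<in> V" "b \<in> V" "c \<in> V" "d \<in> V" using * E(1) by auto
      note inj = criticalD(2)[OF assms]
      have "chords_cross \<theta> b a d c"
        using *(3) V chords_cross_swap[OF inj, of a b c d] chords_cross_swap[OF inj, of c d b a]
          chords_cross_commute[OF inj, of b a c d] chords_cross_commute[OF inj, of d c b a]
        by simp
      then show False using * E(2) unfolding outer_planar_iff by auto
    qed
    moreover have "\<exists>(m, p)\<in>E\<inverse>. m \<notin> U \<and> p \<in> U" if U: "U \<in> F" for U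
      using E(4)[OF U] E(1) by fast
    ultimately show ?thesis
      unfolding coverable_def using E(1,3) by (intro exI[of _ "E\<inverse>"]) auto
  qed
  ultimately show ?thesis using assms unfolding critical_def by blast
qed

definition uncovered :: "'a set set \<Rightarrow> ('a \<times> 'a) set \<Rightarrow> 'a set set" where
  "uncovered F E = {U \<in> F. \<forall>(m, p)\<in>E. p \<in> U \<longrightarrow> m \<in> U}"

text \<open>
  An arc that enters the union or the intersection of two sets enters one of the two sets, so the
  uncovered sets form a crossing family again. The conditions \<open>plus\<close> and \<open>minus\<close> are what makes
  their traces on the remaining vertices a cosigned family: they also ensure that neither meeting
  nor failing to cover is lost when \<open>D\<close> is removed, so no new empty, full or complementary sets
  arise.
\<close>

lemma critical_irreducible:
  assumes crit: "critical V \<theta> F \<sigma>"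
    and D: "D \<subseteq> V" "D \<noteq> {}"
    and E0: "E\<^sub>0 \<subseteq> V \<times> V" "\<And>m p. (m, p) \<in> E\<^sub>0 \<Longrightarrow> \<sigma> m = Minus \<and> \<sigma> p = Plus" "outer_planar \<theta> E\<^sub>0"
      "\<And>a b c d. (a, b) \<in> E\<^sub>0 \<Longrightarrow> c \<in> V - D \<Longrightarrow> d \<in> V - D \<Longrightarrow> \<not> chords_cross \<theta> a b c d"
    and plus: "\<And>X Y. X \<in> uncovered F E\<^sub>0 \<Longrightarrow> Y \<in> uncovered F E\<^sub>0 \<Longrightarrow> X \<inter> Y \<noteq> {} \<Longrightarrow>
      \<exists>v\<in>X \<inter> Y - D. \<sigma> v = Plus"
    and minus: "\<And>X Y. X \<in> uncovered F E\<^sub>0 \<Longrightarrow> Y \<in> uncovered F E\<^sub>0 \<Longrightarrow> X \<union> Y \<noteq> V \<Longrightarrow>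
      \<exists>v\<in>V - (X \<union> Y) - D. \<sigma> v = Minus"
  shows False
proof -
  interpret cosigned_family V F \<sigma> using criticalD(1)[OF crit] .
  let ?V = "V - D" and ?F = "(\<lambda>U. U - D) ` uncovered F E\<^sub>0"
  have unc: "U \<in> F" if "U \<in> uncovered F E\<^sub>0" for U using that unfolding uncovered_def by simp
  have meet: "X \<inter> Y - D \<noteq> {}" if "X \<in> uncovered F E\<^sub>0" "Y \<in> uncovered F E\<^sub>0" "X \<inter> Y \<noteq> {}" for X Y
    using plus[OF that] by blast
  have cov: "V - (X \<union> Y) - D \<noteq> {}" if "X \<in> uncovered F E\<^sub>0" "Y \<in> uncovered F E\<^sub>0" "X \<union> Y \<noteq> V" for X Y
    using minus[OF that] by blast
  have "cosigned_family ?V ?F \<sigma>"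
  proof
    show "finite ?V" using finite_V by simp
    show "?F \<subseteq> Pow ?V - {{}, ?V}"
    proof clarify
      fix U assume U: "U \<in> uncovered F E\<^sub>0"
      have "U - D \<noteq> {}" "?V - U \<noteq> {}"
        using meet[OF U U] cov[OF U U] nonempty[OF unc[OF U]] not_V[OF unc[OF U]] by auto
      then show "U - D \<in> Pow ?V - {{}, ?V}" using subset_V[OF unc[OF U]] by blast
    qed
    show "crossing_family ?V ?F"
      unfolding crossing_family_def
    proof (intro conjI ballI impI)
      show "?F \<subseteq> Pow ?V" using subset_V unc by auto
    next
      fix U W assume "U \<in> ?F" "W \<in> ?F" and ne: "U \<inter> W \<noteq> {} \<and> U \<union> W \<noteq> ?V"
      then obtain X Y where XY: "X \<in> uncovered F E\<^sub>0" "Y \<in> uncovered F E\<^sub>0" "U = X - D" "W = Y - D"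
        by blast
      have ne': "X \<inter> Y \<noteq> {}" "X \<union> Y \<noteq> V" using ne XY(3,4) by auto
      have "X \<inter> Y \<in> uncovered F E\<^sub>0" "X \<union> Y \<in> uncovered F E\<^sub>0"
        using crossing_inter[OF unc[OF XY(1)] unc[OF XY(2)] ne']
          crossing_union[OF unc[OF XY(1)] unc[OF XY(2)] ne'] XY(1,2)
        unfolding uncovered_def by auto
      moreover have "U \<inter> W = X \<inter> Y - D" "U \<union> W = (X \<union> Y) - D" using XY(3,4) by auto
      ultimately show "U \<inter> W \<in> ?F" "U \<union> W \<in> ?F" by auto
    qed
    show "\<not> (\<exists>U\<in>?F. ?V - U \<in> ?F)"
    proof
      assume "\<exists>U\<in>?F. ?V - U \<in> ?F"
      then obtain X Y where XY: "X \<in> uncovered F E\<^sub>0" "Y \<in> uncovered F E\<^sub>0" "?V - (X - D) = Y - D"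
        by blast
      have "X \<inter> Y = {}" "X \<union> Y = V"
        using meet[OF XY(1,2)] cov[OF XY(1,2)] XY(3) by blast+
      then show False using not_complementary unc XY(1,2) by blast
    qed
    show "inter_union_closed_cosigning ?V ?F \<sigma>"
      unfolding inter_union_closed_cosigning_def
    proof (intro conjI ballI impI)
      fix U W assume "U \<in> ?F" "W \<in> ?F"
      then obtain X Y where XY: "X \<in> uncovered F E\<^sub>0" "Y \<in> uncovered F E\<^sub>0" "U = X - D" "W = Y - D"
        by blast
      { assume "U \<inter> W \<noteq> {}"
        then have "X \<inter> Y \<noteq> {}" using XY by auto
        from plus[OF XY(1,2) this] show "\<exists>v\<in>U \<inter> W. \<sigma> v = Plus" using XY by auto }
      { assume "U \<union> W \<noteq> ?V"
        then have "X \<union> Y \<noteq> V" using XY by auto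
        from minus[OF XY(1,2) this] show "\<exists>v\<in>?V - (U \<union> W). \<sigma> v = Minus" using XY by auto }
    qed
  qed
  moreover have "chord_convex ?V \<theta> (U - D)" if "U \<in> uncovered F E\<^sub>0" for U
    using criticalD(3)[OF crit unc[OF that]] unfolding chord_convex_def by auto
  ultimately have "interval_instance ?V \<theta> ?F \<sigma>"
    unfolding interval_instance_def using inj_on_subset[OF criticalD(2)[OF crit]] by auto
  moreover have "card ?V < card V"
    using D finite_V by (intro psubset_card_mono) auto
  ultimately have "coverable ?V \<theta> ?F \<sigma>" using crit unfolding critical_def by blast
  then obtain E where E: "E \<subseteq> ?V \<times> ?V" "outer_planar \<theta> E"
      "\<forall>(m, p)\<in>E. \<sigma> m = Minus \<and> \<sigma> p = Plus" "\<forall>U\<in>?F. \<exists>(m, p)\<in>E. m \<notin> U \<and> p \<in> U"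
    unfolding coverable_def by blast
  have "outer_planar \<theta> (E\<^sub>0 \<union> E)"
    using E(1) by (intro outer_planar_Un[OF criticalD(2)[OF crit] E0(1) _ E0(3) E(2)] E0(4)) auto
  moreover have "\<exists>(m, p)\<in>E\<^sub>0 \<union> E. m \<notin> U \<and> p \<in> U" if U: "U \<in> F" for U
  proof (cases "U \<in> uncovered F E\<^sub>0")
    case True
    then obtain m p where "(m, p) \<in> E" "m \<notin> U - D" "p \<in> U - D" using E(4) by blast
    then show ?thesis using E(1) by blast
  next
    case False
    then show ?thesis using U unfolding uncovered_def by blast
  qed
  ultimately have "coverable V \<theta> F \<sigma>"
    unfolding coverable_def using E(1,3) E0(1,2) by (intro exI[of _ "E\<^sub>0 \<union> E"]) auto
  then show False using criticalD(4)[OF crit] by simp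
qed

text \<open>
  The chord from \<open>m\<close> to \<open>p\<close> crosses nothing, so both the deletion of \<open>p\<close> and that of \<open>m\<close> are
  blocked. The first failure yields \<open>X\<close> and \<open>Y\<close>, the second one \<open>B\<close> and \<open>C\<close>.
\<close>

lemma critical_neighbours:
  assumes crit: "critical V \<theta> F \<sigma>" and mp: "neighbours V \<theta> m p" "\<sigma> m = Minus" "\<sigma> p = Plus"
  shows "tight_pair V F \<sigma> m p \<or> tight_pair V ((-) V ` F) (flip \<circ> \<sigma>) p m"
proof -
  interpret cosigned_family V F \<sigma> using criticalD(1)[OF crit] .
  have V: "m \<in> V" "p \<in> V" and free: "\<And>c d. c \<in> V \<Longrightarrow> d \<in> V \<Longrightarrow> \<not> chords_cross \<theta> m p c d"
    using mp(1) unfolding neighbours_def by auto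
  have planar: "outer_planar \<theta> {(m, p)}" using free V unfolding outer_planar_iff by auto
  have unc: "U \<in> uncovered F {(m, p)} \<longleftrightarrow> U \<in> F \<and> (p \<in> U \<longrightarrow> m \<in> U)" for U
    unfolding uncovered_def by auto
  have minus_ex: "\<exists>v\<in>V - (X \<union> Y). \<sigma> v = Minus" if "X \<in> F" "Y \<in> F" "X \<union> Y \<noteq> V" for X Y
    using cosigning that unfolding inter_union_closed_cosigning_def by blast
  have plus_ex: "\<exists>v\<in>X \<inter> Y. \<sigma> v = Plus" if "X \<in> F" "Y \<in> F" "X \<inter> Y \<noteq> {}" for X Y
    using cosigning that unfolding inter_union_closed_cosigning_def by blast
  obtain X Y where XY: "X \<in> F" "Y \<in> F" "p \<in> X" "p \<in> Y" "m \<in> X" "m \<in> Y"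
    "\<And>v. v \<in> X \<Longrightarrow> v \<in> Y \<Longrightarrow> \<sigma> v = Plus \<Longrightarrow> v = p"
  proof (rule ccontr)
    assume none: "\<not> thesis"
    show False
    proof (rule critical_irreducible[OF crit, of "{p}" "{(m, p)}"])
      fix X Y assume *: "X \<in> uncovered F {(m, p)}" "Y \<in> uncovered F {(m, p)}"
      { assume "X \<inter> Y \<noteq> {}"
        then obtain v where v: "v \<in> X" "v \<in> Y" "\<sigma> v = Plus"
          using plus_ex[of X Y] * unfolding unc by blast
        show "\<exists>v\<in>X \<inter> Y - {p}. \<sigma> v = Plus"
        proof (rule ccontr)
          assume no: "\<not> ?thesis"
          then have "v = p" using v by auto
          then show False using none that[of X Y] v * no unfolding unc by blast
        qed }
      assume "X \<union> Y \<noteq> V"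
      then obtain v where "v \<in> V - (X \<union> Y)" "\<sigma> v = Minus"
        using minus_ex[of X Y] * unfolding unc by blast
      then show "\<exists>v\<in>V - (X \<union> Y) - {p}. \<sigma> v = Minus" using mp(3) by auto
    qed (use V mp planar free in auto)
  qed
  obtain B C where BC: "B \<in> F" "C \<in> F" "p \<notin> B" "p \<notin> C" "m \<notin> B" "m \<notin> C"
    "\<And>v. v \<in> V \<Longrightarrow> \<sigma> v = Minus \<Longrightarrow> v = m \<or> v \<in> B \<or> v \<in> C"
  proof (rule ccontr)
    assume none: "\<not> thesis"
    show False
    proof (rule critical_irreducible[OF crit, of "{m}" "{(m, p)}"])
      fix X Y assume *: "X \<in> uncovered F {(m, p)}" "Y \<in> uncovered F {(m, p)}"
      { assume "X \<union> Y \<noteq> V"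
        then obtain v where v: "v \<in> V" "v \<notin> X" "v \<notin> Y" "\<sigma> v = Minus"
          using minus_ex[of X Y] * unfolding unc by blast
        show "\<exists>v\<in>V - (X \<union> Y) - {m}. \<sigma> v = Minus"
        proof (rule ccontr)
          assume no: "\<not> ?thesis"
          then have "v = m" using v by auto
          then show False using none that[of X Y] v * no unfolding unc by blast
        qed }
      assume "X \<inter> Y \<noteq> {}"
      then obtain v where "v \<in> X \<inter> Y" "\<sigma> v = Plus"
        using plus_ex[of X Y] * unfolding unc by blast
      then show "\<exists>v\<in>X \<inter> Y - {m}. \<sigma> v = Plus" using mp(2) by auto
    qed (use V mp planar free in auto)
  qed
  show ?thesis
  proof (cases "X \<union> Y = V")
    case False
    then have "X \<inter> Y \<in> F" using crossing_inter[OF XY(1,2)] XY(3,4) by blast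
    then have "tight_pair V F \<sigma> m p"
    proof (rule tight_pair_if_inter_in_F[OF _ _ _ _ BC(1,2,5,6,3,4)])
      show "v = p" if "v \<in> X \<inter> Y" "\<sigma> v = Plus" for v using XY(7)[of v] that by simp
      show "v = m \<or> v \<in> B \<or> v \<in> C" if "v \<in> V" "\<sigma> v = Minus" for v using BC(7)[OF that] .
    qed (use XY(3-6) in auto)
    then show ?thesis ..
  next
    case cover: True
    have "B \<inter> C \<noteq> {}"
      using no_doubly_covering_quadruple[OF XY(1,2) BC(1,2) cover XY(5,6) _ _ BC(3,4)] XY(7) BC(7) by metis
    moreover have "B \<union> C \<noteq> V" using BC(3,4) V(2) by blast
    ultimately have BCF: "B \<union> C \<in> F" using crossing_union[OF BC(1,2)] by simp
    interpret dual: cosigned_family V "(-) V ` F" "flip \<circ> \<sigma>" by (rule dual)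
    have "tight_pair V ((-) V ` F) (flip \<circ> \<sigma>) p m"
    proof (rule dual.tight_pair_if_inter_in_F)
      show "V - (B \<union> C) \<in> (-) V ` F" "V - X \<in> (-) V ` F" "V - Y \<in> (-) V ` F"
        using BCF XY(1,2) by blast+
      show "v = m" if "v \<in> V - (B \<union> C)" "(flip \<circ> \<sigma>) v = Plus" for v
        using BC(7)[of v] that by auto
      show "v = p \<or> v \<in> V - X \<or> v \<in> V - Y" if "v \<in> V" "(flip \<circ> \<sigma>) v = Minus" for v
        using XY(7)[of v] that by auto
    qed (use V XY(3-6) BC(3-6) in auto)
    then show ?thesis ..
  qed
qed

section \<open>Straightening the circle\<close>

lemma same_crossings_rotate_to:
  assumes "\<forall>u\<in>V. \<forall>v\<in>V. \<theta> u - \<theta> v < K" "m \<in> V"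
  shows "same_crossings V \<theta> (rotate_to K \<theta> m)"
  unfolding same_crossings_def chords_cross_def separates_def
  by (simp add: rotate_to_ccw[OF assms])

lemma same_crossings_mirror:
  assumes "inj_on \<theta> V"
  shows "same_crossings V \<theta> (\<lambda>v. - \<theta> v)"
proof -
  have "inj_on (\<lambda>v. - \<theta> v) V" using assms by (auto simp: inj_on_def)
  then show ?thesis
    unfolding same_crossings_def
    by (auto simp: chords_cross_iff_less[OF assms] chords_cross_iff_less[where V = V and \<theta> = "\<lambda>v. - \<theta> v"]
        minus_max_eq_min[symmetric] minus_min_eq_max[symmetric] less_minus_iff minus_less_iff)
qed

lemma same_crossings_trans:
  "same_crossings V \<theta>\<^sub>1 \<theta>\<^sub>2 \<Longrightarrow> same_crossings V \<theta>\<^sub>2 \<theta>\<^sub>3 \<Longrightarrow> same_crossings V \<theta>\<^sub>1 \<theta>\<^sub>3"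
  unfolding same_crossings_def by simp

lemma neighbours_same_crossings:
  "same_crossings V \<theta> \<theta>' \<Longrightarrow> neighbours V \<theta>' a b \<longleftrightarrow> neighbours V \<theta> a b"
  unfolding same_crossings_def neighbours_def by blast

lemma neighbours_commute:
  "inj_on \<theta> V \<Longrightarrow> neighbours V \<theta> a b \<Longrightarrow> neighbours V \<theta> b a"
  unfolding neighbours_def using chords_cross_swap[of \<theta> V] by blast

lemma neighbours_consecutive:
  assumes "inj_on \<theta> V" "a \<in> V" "b \<in> V" "\<theta> a < \<theta> b"
    "\<And>v. v \<in> V \<Longrightarrow> \<theta> v \<le> \<theta> a \<or> \<theta> b \<le> \<theta> v"
  shows "neighbours V \<theta> a b"
  using assms(4,5) unfolding neighbours_def
  by (auto simp: chords_cross_iff_less[OF assms(1-3)] assms(2,3) not_less[symmetric])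

lemma neighbours_extremes:
  assumes "inj_on \<theta> V" "a \<in> V" "b \<in> V" "a \<noteq> b"
    "\<And>v. v \<in> V \<Longrightarrow> \<theta> a \<le> \<theta> v" "\<And>v. v \<in> V \<Longrightarrow> \<theta> v \<le> \<theta> b"
  shows "neighbours V \<theta> a b"
proof -
  have "\<theta> a < \<theta> v \<and> \<theta> v < \<theta> b" if "v \<in> V" "v \<noteq> a" "v \<noteq> b" for v
    using that assms(5,6)[OF that(1)] assms(1-3) by (auto simp: order_less_le inj_on_eq_iff)
  then show ?thesis
    using assms(4) assms(5)[OF assms(3)] unfolding neighbours_def
    by (auto simp: chords_cross_iff_less[OF assms(1-3)] assms(2,3))
qed

text \<open>
  Since no chord crosses the one from \<open>m\<close> to \<open>p\<close>, one of the two sides between \<open>m\<close> and \<open>p\<close> is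
  empty. If it is the wrong one, a reflection puts it right.
\<close>

lemma neighbours_first_two:
  assumes "finite V" "inj_on \<theta> V" "neighbours V \<theta> m p"
  shows "\<exists>\<theta>'. inj_on \<theta>' V \<and> same_crossings V \<theta> \<theta>' \<and>
    (\<forall>v\<in>V - {m}. \<theta>' m < \<theta>' v) \<and> (\<forall>v\<in>V - {m, p}. \<theta>' p < \<theta>' v)"
proof -
  have mp: "m \<in> V" "p \<in> V" "m \<noteq> p" using assms(3) unfolding neighbours_def by auto
  obtain K where K: "\<forall>u\<in>V. \<forall>v\<in>V. \<theta> u - \<theta> v < K"
    using finite_spread_bound[OF assms(1), of \<theta>] by auto
  define \<theta>\<^sub>1 where "\<theta>\<^sub>1 = rotate_to K \<theta> m"
  note inj1 = rotate_to_least(1)[OF K assms(2) mp(1), folded \<theta>\<^sub>1_def]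
    and min1 = rotate_to_least(2)[OF K assms(2) mp(1), folded \<theta>\<^sub>1_def]
    and same1 = same_crossings_rotate_to[where \<theta> = \<theta>, OF K mp(1), folded \<theta>\<^sub>1_def]
  show ?thesis
  proof (cases "\<exists>x\<in>V. x \<noteq> m \<and> x \<noteq> p \<and> \<theta>\<^sub>1 x < \<theta>\<^sub>1 p")
    case False
    then have "\<theta>\<^sub>1 p < \<theta>\<^sub>1 v" if "v \<in> V" "v \<noteq> m" "v \<noteq> p" for v
      using that inj1 mp(2) by (metis inj_onD linorder_neqE_linordered_idom)
    then show ?thesis using inj1 same1 min1 by (intro exI[of _ \<theta>\<^sub>1]) simp
  next
    case True
    then obtain x where x: "x \<in> V" "x \<noteq> m" "x \<noteq> p" "\<theta>\<^sub>1 x < \<theta>\<^sub>1 p" by blast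
    have max1: "\<theta>\<^sub>1 y < \<theta>\<^sub>1 p" if y: "y \<in> V" "y \<noteq> p" for y
    proof (rule ccontr)
      assume "\<not> \<theta>\<^sub>1 y < \<theta>\<^sub>1 p"
      then have "\<theta>\<^sub>1 p < \<theta>\<^sub>1 y" "y \<noteq> m" "y \<noteq> x"
        using inj1 y mp x min1[OF mp(2)] by (auto simp: inj_on_def order_less_le)
      then have "chords_cross \<theta>\<^sub>1 m p x y"
        unfolding chords_cross_iff_less[OF inj1 mp(1,2) x(1) y(1)]
        using min1[OF x(1,2)] min1[OF mp(2)] x y mp by auto
      then show False
        using assms(3) neighbours_same_crossings[OF same1] x(1) y(1) unfolding neighbours_def by metis
    qed
    define \<theta>\<^sub>2 where "\<theta>\<^sub>2 = (\<lambda>v. - \<theta>\<^sub>1 v)"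
    have inj2: "inj_on \<theta>\<^sub>2 V" using inj1 unfolding \<theta>\<^sub>2_def inj_on_def by simp
    have same2: "same_crossings V \<theta>\<^sub>1 \<theta>\<^sub>2" unfolding \<theta>\<^sub>2_def by (rule same_crossings_mirror[OF inj1])
    obtain L where L: "\<forall>u\<in>V. \<forall>v\<in>V. \<theta>\<^sub>2 u - \<theta>\<^sub>2 v < L"
      using finite_spread_bound[OF assms(1), of "\<theta>\<^sub>2"] by auto
    define \<theta>\<^sub>3 where "\<theta>\<^sub>3 = rotate_to L \<theta>\<^sub>2 m"
    note inj3 = rotate_to_least(1)[OF L inj2 mp(1), folded \<theta>\<^sub>3_def]
      and min3 = rotate_to_least(2)[OF L inj2 mp(1), folded \<theta>\<^sub>3_def]
      and same3 = same_crossings_rotate_to[where \<theta> = "\<theta>\<^sub>2", OF L mp(1), folded \<theta>\<^sub>3_def]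
    have "\<theta>\<^sub>3 p < \<theta>\<^sub>3 v" if "v \<in> V" "v \<noteq> m" "v \<noteq> p" for v
      using max1[OF that(1,3)] min1[OF that(1,2)] min1[OF mp(2)] mp(3)
      unfolding \<theta>\<^sub>3_def \<theta>\<^sub>2_def rotate_to_def by simp
    then show ?thesis
      using inj3 same_crossings_trans[OF same1 same_crossings_trans[OF same2 same3]] min3
      by (intro exI[of _ \<theta>\<^sub>3]) simp
  qed
qed

section \<open>Tight pairs\<close>

lemma critical_neighbours_pair:
  assumes "critical V \<theta> F \<sigma>" "neighbours V \<theta> m p" "\<sigma> m = Minus" "\<sigma> p = Plus"
  shows "{m, p} \<in> F \<or> V - {m, p} \<in> F"
proof -
  interpret cosigned_family V F \<sigma> using criticalD(1)[OF assms(1)] .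
  have "V - (V - X) = X" if "X \<in> F" for X using subset_V[OF that] by blast
  then have "{p, m} \<in> (-) V ` F \<Longrightarrow> V - {m, p} \<in> F" by (auto simp: insert_commute)
  then show ?thesis using critical_neighbours[OF assms] unfolding tight_pair_def by auto
qed

text \<open>
  The circle is cut open so that \<open>m\<close> comes first, then \<open>p\<close> and possibly further positive vertices,
  then the first vertex \<open>q\<close> of a smallest admissible \<open>C\<close>, and \<open>t\<close> comes last. Then \<open>t\<close> is adjacent to \<open>m\<close> on the circle, and chords from
  \<open>t\<close> to the vertices up to \<open>q\<close> cross only chords with an endpoint before \<open>q\<close>.
\<close>

lemma no_straightened_tight_pair:
  assumes crit: "critical V \<theta> F \<sigma>"
    and mp: "m \<in> V" "p \<in> V" "\<sigma> m = Minus" "\<sigma> p = Plus" "{m, p} \<in> F"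
    and first: "\<And>v. v \<in> V \<Longrightarrow> v \<noteq> m \<Longrightarrow> \<theta> m < \<theta> v"
      "\<And>v. v \<in> V \<Longrightarrow> v \<noteq> m \<Longrightarrow> v \<noteq> p \<Longrightarrow> \<theta> p < \<theta> v"
    and t: "t \<in> V" "\<sigma> t = Minus" "\<And>v. v \<in> V \<Longrightarrow> \<theta> v \<le> \<theta> t" "t \<in> B"
    and B: "B \<in> F" "m \<notin> B" "p \<notin> B"
    and C\<^sub>0: "C\<^sub>0 \<in> F" "B \<inter> C\<^sub>0 = {}" "m \<notin> C\<^sub>0" "p \<notin> C\<^sub>0"
      "\<And>v. v \<in> V \<Longrightarrow> \<sigma> v = Minus \<Longrightarrow> v = m \<or> v \<in> B \<or> v \<in> C\<^sub>0"
  shows False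
proof -
  interpret cosigned_family V F \<sigma> using criticalD(1)[OF crit] .
  have inj: "inj_on \<theta> V" by (rule criticalD(2)[OF crit])
  define good where "good C \<longleftrightarrow> C \<in> F \<and> B \<inter> C = {} \<and> m \<notin> C \<and> p \<notin> C \<and>
    (\<forall>v\<in>V. \<sigma> v = Minus \<longrightarrow> v = m \<or> v \<in> B \<or> v \<in> C)" for C
  have "good C\<^sub>0" unfolding good_def using C\<^sub>0 by blast
  then obtain C where good_C: "good C" and C_least: "\<And>C'. good C' \<Longrightarrow> card C \<le> card C'"
    using ex_has_least_nat[of good C\<^sub>0 card] by blast
  have C: "C \<in> F" "B \<inter> C = {}" "m \<notin> C" "p \<notin> C"
    and cover: "\<And>v. v \<in> V \<Longrightarrow> \<sigma> v = Minus \<Longrightarrow> v = m \<or> v \<in> B \<or> v \<in> C"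
    using good_C unfolding good_def by blast+
  have fin_C: "finite C" using finite_subset[OF subset_V[OF C(1)] finite_V] .
  have "Min (\<theta> ` C) \<in> \<theta> ` C" using fin_C nonempty[OF C(1)] by simp
  then obtain q where q: "q \<in> C" "\<theta> q = Min (\<theta> ` C)" by auto
  have p_ne_m: "p \<noteq> m" using mp(3,4) by auto
  from q have q_least: "\<And>v. v \<in> C \<Longrightarrow> \<theta> q \<le> \<theta> v" using fin_C by simp
  have qV: "q \<in> V" and qB: "q \<notin> B" "q \<noteq> t" "q \<noteq> m" "q \<noteq> p"
    using q C t subset_V[OF C(1)] by auto
  have qt: "\<theta> q < \<theta> t" using t(1,3) qV qB(2) inj by (metis inj_onD order_less_le)
  have mq: "\<theta> m < \<theta> q" and pq: "\<theta> p < \<theta> q" using first qV qB by auto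
  \<comment> \<open>A vertex \<open>v\<close> of \<open>B\<close> before \<open>q\<close> would contradict that \<open>B\<close> is an interval, since \<open>m\<close> and \<open>q\<close>
    separate it from \<open>t\<close>.\<close>
  have before: "v \<notin> B \<and> v \<notin> C \<and> \<sigma> v = Plus" if v: "v \<in> V" "\<theta> v < \<theta> q" "v \<noteq> m" for v
  proof -
    have "v \<notin> B"
    proof
      assume "v \<in> B"
      have "v \<noteq> t" "v \<noteq> q" "m \<noteq> t" using v(2) qt mq by auto
      then have "chords_cross \<theta> v t m q"
        unfolding chords_cross_iff_less[OF inj v(1) t(1) mp(1) qV]
        using first(1)[OF v(1,3)] v qt qB by auto
      then show False
        using criticalD(3)[OF crit B(1)] \<open>v \<in> B\<close> t(4) mp(1) B(2) qV qB(1)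
        unfolding chord_convex_def by blast
    qed
    moreover have "v \<notin> C" using q_least[of v] v(2) by auto
    ultimately show ?thesis using cover[OF v(1)] v(3) by (cases "\<sigma> v") auto
  qed
  \<comment> \<open>The predecessor \<open>r\<close> of \<open>q\<close> is positive. If \<open>q\<close> were negative, then \<open>{q, r}\<close> or its complement
    would be in \<open>F\<close>. The former meets \<open>C\<close> in \<open>q\<close> alone, and the latter misses, jointly with \<open>C\<close>,
    only \<open>r\<close>.\<close>
  have q_Plus: "\<sigma> q = Plus"
  proof (rule ccontr)
    assume "\<sigma> q \<noteq> Plus"
    then have q_Minus: "\<sigma> q = Minus" by (simp add: not_Plus_iff)
    let ?S = "{v \<in> V. \<theta> v < \<theta> q}"
    have fin: "finite ?S" using finite_V by simp
    have "p \<in> ?S" using pq mp(2) by simp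
    then have "Max (\<theta> ` ?S) \<in> \<theta> ` ?S" using fin by (intro Max_in) auto
    then obtain r where r: "r \<in> V" "\<theta> r < \<theta> q" "\<theta> r = Max (\<theta> ` ?S)" by auto
    then have r_greatest: "\<theta> v \<le> \<theta> r" if "v \<in> V" "\<theta> v < \<theta> q" for v
      using that fin by simp
    have "\<theta> p \<le> \<theta> r" using r_greatest mp(2) pq by simp
    then have "r \<noteq> m" using first(1)[OF mp(2) p_ne_m] by auto
    then have r': "r \<notin> B" "r \<notin> C" "\<sigma> r = Plus" using before[OF r(1,2)] by auto
    have "neighbours V \<theta> r q"
      using r_greatest r(1,2) qV inj by (intro neighbours_consecutive) (auto simp: not_less)
    then have "{q, r} \<in> F \<or> V - {q, r} \<in> F"
      using critical_neighbours_pair[OF crit neighbours_commute[OF inj] q_Minus r'(3)] by blast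
    then show False
    proof
      assume "{q, r} \<in> F"
      then obtain v where "v \<in> {q, r}" "v \<in> C" "\<sigma> v = Plus"
        using plus_in_inter[OF _ C(1), of "{q, r}"] q(1) by blast
      then show False using r'(2) q_Minus by auto
    next
      assume "V - {q, r} \<in> F"
      then obtain v where "v \<in> V" "v \<notin> V - {q, r}" "v \<notin> C" "\<sigma> v = Minus"
        using minus_outside_union[OF _ C(1), of "V - {q, r}"] r(1) r'(2) by blast
      then show False using r'(3) q(1) by auto
    qed
  qed
  let ?D = "{v \<in> V. \<theta> v < \<theta> q}"
  let ?E = "insert (m, p) {(t, x) | x. x \<in> V \<and> \<theta> x \<le> \<theta> q \<and> \<sigma> x = Plus}"
  have mp_free: "\<not> chords_cross \<theta> m p c d" if "c \<in> V" "d \<in> V" for c d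
    unfolding chords_cross_iff_less[OF inj mp(1,2) that]
    using first(1)[OF mp(2)] first(2)[OF that(1)] first(2)[OF that(2)] mp(3,4) by fastforce
  have tx_free: "\<not> chords_cross \<theta> t x c d"
    if "x \<in> V" "\<theta> x \<le> \<theta> q" "c \<in> V" "d \<in> V" "\<not> \<theta> c < \<theta> q" "\<not> \<theta> d < \<theta> q" for x c d
    unfolding chords_cross_iff_less[OF inj t(1) that(1,3,4)]
    using that qt t(3)[OF that(3)] t(3)[OF that(4)] inj t(1) by (auto simp: inj_on_eq_iff order_less_le)
  have planar: "outer_planar \<theta> ?E"
    unfolding outer_planar_iff
    using mp_free mp(1,2) t(1) chords_cross_commute[OF inj _ _ mp(1,2)]
    by (auto simp: chords_cross_def[of \<theta> t _ t])
  have unc: "X \<in> F" "p \<in> X \<Longrightarrow> m \<in> X"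
      "\<And>x. x \<in> X \<Longrightarrow> \<theta> x \<le> \<theta> q \<Longrightarrow> \<sigma> x = Plus \<Longrightarrow> t \<in> X"
    if X: "X \<in> uncovered F ?E" for X
  proof -
    show "X \<in> F" "p \<in> X \<Longrightarrow> m \<in> X" using X unfolding uncovered_def by auto
    show "\<And>x. x \<in> X \<Longrightarrow> \<theta> x \<le> \<theta> q \<Longrightarrow> \<sigma> x = Plus \<Longrightarrow> t \<in> X"
      using X subset_V[of X] unfolding uncovered_def by auto
  qed
  have B_late: "\<not> \<theta> v < \<theta> q" if "v \<in> B" for v
    using before[of v] that subset_V[OF B(1)] B(2) by auto
  \<comment> \<open>Such a set \<open>K\<close> and \<open>{m, p}\<close> would be disjoint and contain all negative vertices.\<close>
  have no_late_cover: False
    if K: "K \<in> F" "m \<notin> K" "p \<notin> K" "\<And>v. v \<in> V \<Longrightarrow> \<sigma> v = Minus \<Longrightarrow> v = m \<or> v \<in> K" for K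
  proof -
    obtain v where "v \<in> V" "v \<notin> {m, p}" "v \<notin> K" "\<sigma> v = Minus"
      using disjoint_misses_minus[OF mp(5) K(1)] K(2,3) by auto
    then show False using K(4) by auto
  qed
  \<comment> \<open>Two uncovered sets that miss only the negative vertex \<open>m\<close> would cut \<open>C\<close> down to \<open>C \<inter> Y\<close>, which
    no longer contains \<open>q\<close>, against the minimality of \<open>C\<close>.\<close>
  have no_split: False
    if X: "X \<in> uncovered F ?E" and Y: "Y \<in> uncovered F ?E" and "m \<notin> X" "m \<notin> Y" "t \<in> X"
      and XY: "\<And>v. v \<in> V \<Longrightarrow> \<sigma> v = Minus \<Longrightarrow> v = m \<or> v \<in> X \<or> v \<in> Y" for X Y
  proof -
    note XF = unc(1)[OF X] and YF = unc(1)[OF Y]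
    have p: "p \<notin> X" "p \<notin> Y" using unc(2) X Y that(3,4) by blast+
    have disj: "X \<inter> Y = {}"
    proof (rule ccontr)
      assume "X \<inter> Y \<noteq> {}"
      then have "X \<union> Y \<in> F" using crossing_union[OF XF YF] mp(1) that(3,4) by blast
      then show False using no_late_cover[of "X \<union> Y"] XY p that(3,4) by blast
    qed
    then have "t \<notin> Y" using \<open>t \<in> X\<close> by blast
    then have "q \<notin> Y" using unc(3)[OF Y, of q] q_Plus by auto
    have CX: "C \<inter> X = {}"
    proof (rule ccontr)
      assume "C \<inter> X \<noteq> {}"
      then have "C \<union> X \<in> F" using crossing_union[OF C(1) XF] mp(1) that(3) C(3) by blast
      then have "B \<union> (C \<union> X) \<in> F"
        using crossing_union[OF B(1), of "C \<union> X"] mp(1) that(3) C(3) B(2) t(4) \<open>t \<in> X\<close> by blast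
      then show False
        using no_late_cover[of "B \<union> (C \<union> X)"] cover p(1) C(3,4) B(2,3) that(3) by blast
    qed
    obtain w where w: "w \<in> V" "w \<notin> {m, p}" "w \<notin> B" "\<sigma> w = Minus"
      using disjoint_misses_minus[OF mp(5) B(1)] B(2,3) by auto
    then have "w \<in> C" using cover by auto
    then have "w \<in> Y" using XY[OF w(1,4)] w(2) CX by auto
    have CY: "C \<inter> Y \<in> F"
      using crossing_inter[OF C(1) YF] \<open>w \<in> C\<close> \<open>w \<in> Y\<close> mp(1) that(4) C(3) by blast
    have "v = m \<or> v \<in> B \<or> v \<in> C \<inter> Y" if "v \<in> V" "\<sigma> v = Minus" for v
      using cover[OF that] XY[OF that] CX by blast
    then have "good (C \<inter> Y)" unfolding good_def using CY C by blast
    moreover have "card (C \<inter> Y) < card C"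
      using fin_C q(1) \<open>q \<notin> Y\<close> by (intro psubset_card_mono) auto
    ultimately show False using C_least[of "C \<inter> Y"] by simp
  qed
  show False
  proof (rule critical_irreducible[OF crit, of ?D ?E])
    show "?D \<subseteq> V" "?D \<noteq> {}" using mp(1) mq by auto
    show "?E \<subseteq> V \<times> V" using mp t by auto
    show "\<sigma> a = Minus \<and> \<sigma> b = Plus" if "(a, b) \<in> ?E" for a b using that mp t by auto
    show "outer_planar \<theta> ?E" by (rule planar)
    show "\<not> chords_cross \<theta> a b c d" if "(a, b) \<in> ?E" "c \<in> V - ?D" "d \<in> V - ?D" for a b c d
      using that mp_free tx_free by auto
  next
    fix X Y assume X: "X \<in> uncovered F ?E" and Y: "Y \<in> uncovered F ?E"
    note XF = unc(1)[OF X] and YF = unc(1)[OF Y]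
    { assume "X \<inter> Y \<noteq> {}"
      then obtain v where v: "v \<in> X" "v \<in> Y" "v \<in> V" "\<sigma> v = Plus"
        using plus_in_inter[OF XF YF] by metis
      \<comment> \<open>When the shared positive vertex \<open>v\<close> is to be deleted, both sets contain \<open>t\<close>, and a
        replacement is found in \<open>B\<close>, which lies entirely beyond \<open>q\<close>, or else is \<open>q\<close> itself.\<close>
      have in_B: "\<exists>v\<in>X \<inter> Y - ?D. \<sigma> v = Plus"
        if RS: "R \<in> F" "S \<in> F" "t \<in> R" "t \<in> S" "R \<union> B \<noteq> V" "R \<inter> S = X \<inter> Y" for R S
      proof -
        have "R \<inter> B \<in> F" using crossing_inter[OF RS(1) B(1)] RS(3,5) t(4) by blast
        then obtain u where "u \<in> R \<inter> B" "u \<in> S" "\<sigma> u = Plus"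
          using plus_in_inter[OF _ RS(2), of "R \<inter> B"] RS(3,4) t(4) by blast
        then show ?thesis using B_late[of u] RS(6) by blast
      qed
      show "\<exists>v\<in>X \<inter> Y - ?D. \<sigma> v = Plus"
      proof (cases "\<theta> v < \<theta> q")
        case False
        then show ?thesis using v by blast
      next
        case True
        then have tXY: "t \<in> X" "t \<in> Y" using unc(3) X Y v by force+
        consider "X \<union> B \<noteq> V" | "Y \<union> B \<noteq> V" | "X \<union> B = V" "Y \<union> B = V" by blast
        then show ?thesis
        proof cases
          case 1
          then show ?thesis using in_B[OF XF YF tXY] by blast
        next
          case 2
          then show ?thesis using in_B[OF YF XF tXY(2,1)] by blast
        next
          case 3
          then have "q \<in> X \<inter> Y" using qV qB(1) by blast
          then show ?thesis using q_Plus by auto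
        qed
      qed }
    assume "X \<union> Y \<noteq> V"
    then obtain w where w: "w \<in> V" "w \<notin> X" "w \<notin> Y" "\<sigma> w = Minus"
      using minus_outside_union[OF XF YF] by metis
    show "\<exists>v\<in>V - (X \<union> Y) - ?D. \<sigma> v = Minus"
    proof (rule ccontr)
      assume none: "\<not> ?thesis"
      have early: "v = m" if "v \<in> V" "v \<notin> X" "v \<notin> Y" "\<sigma> v = Minus" for v
        using none that before[of v] by force
      have "m \<notin> X" "m \<notin> Y" using early[OF w] w by auto
      moreover have "t \<noteq> m" using t(4) B(2) by blast
      then have "t \<in> X \<or> t \<in> Y" using early[OF t(1) _ _ t(2)] by blast
      ultimately show False
        using no_split[OF X Y] no_split[OF Y X] early by blast
    qed
  qed
qed

text \<open>
  The vertex on the other side of \<open>m\<close> must be negative, and the roles of \<open>B\<close> and \<open>C\<close> are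
  distributed according to which of the two contains it.
\<close>

lemma critical_no_tight_pair:
  assumes crit: "critical V \<theta> F \<sigma>" and nb: "neighbours V \<theta> m p" "\<sigma> m = Minus" "\<sigma> p = Plus"
    and tight: "tight_pair V F \<sigma> m p"
  shows False
proof -
  interpret cosigned_family V F \<sigma> using criticalD(1)[OF crit] .
  have mp: "m \<in> V" "p \<in> V" "m \<noteq> p" using nb(1) unfolding neighbours_def by auto
  obtain \<theta>' where \<theta>': "inj_on \<theta>' V" "same_crossings V \<theta> \<theta>'"
    and first: "\<And>v. v \<in> V \<Longrightarrow> v \<noteq> m \<Longrightarrow> \<theta>' m < \<theta>' v"
      "\<And>v. v \<in> V \<Longrightarrow> v \<noteq> m \<Longrightarrow> v \<noteq> p \<Longrightarrow> \<theta>' p < \<theta>' v"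
    using neighbours_first_two[OF finite_V criticalD(2)[OF crit] nb(1)] by auto
  have crit': "critical V \<theta>' F \<sigma>" using critical_same_crossings[OF crit \<theta>'(2,1)] .
  obtain B C where BC: "{m, p} \<in> F" "B \<in> F" "C \<in> F" "B \<inter> C = {}" "m \<notin> B" "m \<notin> C" "p \<notin> B" "p \<notin> C"
    "\<And>v. v \<in> V \<Longrightarrow> \<sigma> v = Minus \<Longrightarrow> v = m \<or> v \<in> B \<or> v \<in> C"
    using tight unfolding tight_pair_def by blast
  have "Max (\<theta>' ` V) \<in> \<theta>' ` V" using finite_V mp(1) by (intro Max_in) auto
  then obtain t where t: "t \<in> V" "\<theta>' t = Max (\<theta>' ` V)" by auto
  then have t_greatest: "\<And>v. v \<in> V \<Longrightarrow> \<theta>' v \<le> \<theta>' t" using finite_V by simp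
  obtain b where b: "b \<in> B" "b \<in> V" using nonempty[OF BC(2)] subset_V[OF BC(2)] by blast
  then have "b \<noteq> m" "b \<noteq> p" using BC by auto
  then have "\<theta>' p < \<theta>' t" using first(2)[OF b(2)] t_greatest[OF b(2)] by simp
  then have tmp: "t \<noteq> m" "t \<noteq> p" using first(1)[OF mp(2)] mp(3) by auto
  have t_Minus: "\<sigma> t = Minus"
  proof (rule ccontr)
    assume "\<sigma> t \<noteq> Minus"
    then have t_Plus: "\<sigma> t = Plus" by (cases "\<sigma> t") auto
    have "neighbours V \<theta>' m t"
      using first(1) t_greatest tmp(1) mp(1) t(1) \<theta>'(1) by (intro neighbours_extremes) force+
    \<comment> \<open>The set \<open>{m, t}\<close> meets \<open>{m, p}\<close> in \<open>m\<close> alone; its complement and \<open>{m, p}\<close> miss \<open>t\<close> alone.\<close>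
    then consider "{m, t} \<in> F" | "V - {m, t} \<in> F"
      using critical_neighbours_pair[OF crit' _ nb(2) t_Plus] by blast
    then show False
    proof cases
      case 1
      then obtain v where "v \<in> {m, t}" "v \<in> {m, p}" "\<sigma> v = Plus"
        using plus_in_inter[OF _ BC(1), of "{m, t}"] by blast
      then show False using tmp nb(2) by auto
    next
      case 2
      then obtain v where "v \<notin> V - {m, t}" "v \<in> V" "v \<notin> {m, p}" "\<sigma> v = Minus"
        using minus_outside_union[OF _ BC(1), of "V - {m, t}"] tmp t(1) by blast
      then show False using t_Plus by auto
    qed
  qed
  have CB: "C \<inter> B = {}" using BC(4) by auto
  consider "t \<in> B" | "t \<in> C" using BC(9)[OF t(1) t_Minus] tmp(1) by blast
  then show False
  proof cases
    case 1
    show False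
      by (rule no_straightened_tight_pair[OF crit' mp(1,2) nb(2,3) BC(1) first t(1) t_Minus t_greatest 1
          BC(2,5,7,3,4,6,8)]) (use BC(9) in blast)+
  next
    case 2
    show False
      by (rule no_straightened_tight_pair[OF crit' mp(1,2) nb(2,3) BC(1) first t(1) t_Minus t_greatest 2
          BC(3,6,8,2) CB BC(5,7)]) (use BC(9) in blast)+
  qed
qed

text \<open>
  Two vertices of opposite sign at the smallest possible distance on the line have nothing between
  them, since a vertex in between would have the sign opposite to one of them.
\<close>

lemma exists_opposite_neighbours:
  assumes "finite V" "inj_on \<theta> V" "a \<in> V" "\<sigma> a = Minus" "b \<in> V" "\<sigma> b = Plus"
  obtains m p where "neighbours V \<theta> m p" "\<sigma> m = Minus" "\<sigma> p = Plus"
proof -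
  let ?P = "{(m, p). m \<in> V \<and> p \<in> V \<and> \<sigma> m = Minus \<and> \<sigma> p = Plus}"
  let ?d = "\<lambda>(m, p). \<bar>\<theta> m - \<theta> p\<bar>"
  have fin: "finite ?P" using finite_subset[of ?P "V \<times> V"] assms(1) by auto
  moreover have "(a, b) \<in> ?P" using assms by simp
  ultimately have "Min (?d ` ?P) \<in> ?d ` ?P" by (intro Min_in) auto
  then obtain m p where mp: "m \<in> V" "p \<in> V" "\<sigma> m = Minus" "\<sigma> p = Plus"
    "\<bar>\<theta> m - \<theta> p\<bar> = Min (?d ` ?P)" by auto
  have least: "\<bar>\<theta> m - \<theta> p\<bar> \<le> \<bar>\<theta> m' - \<theta> p'\<bar>"
    if "m' \<in> V" "p' \<in> V" "\<sigma> m' = Minus" "\<sigma> p' = Plus" for m' p'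
  proof -
    have "?d (m', p') \<in> ?d ` ?P" using that by (intro imageI) simp
    then show ?thesis using fin mp(5) by (metis (no_types, lifting) Min_le case_prod_conv finite_imageI)
  qed
  have "m \<noteq> p" using mp(3,4) by auto
  then have ne: "\<theta> m \<noteq> \<theta> p" using mp(1,2) assms(2) by (auto simp: inj_on_eq_iff)
  have between: "\<not> (\<theta> m < \<theta> v \<and> \<theta> v < \<theta> p)" "\<not> (\<theta> p < \<theta> v \<and> \<theta> v < \<theta> m)" if "v \<in> V" for v
    using least[of v p] least[of m v] that mp by (cases "\<sigma> v"; auto)+
  have "neighbours V \<theta> m p"
  proof (cases "\<theta> m < \<theta> p")
    case True
    then show ?thesis
      using between(1) mp(1,2) assms(2) by (intro neighbours_consecutive) (auto simp: not_less)
  next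
    case False
    then show ?thesis
      using between(2) mp(1,2) assms(2) ne
      by (intro neighbours_commute[OF assms(2) neighbours_consecutive]) (auto simp: not_less)
  qed
  then show ?thesis using that mp(3,4) by blast
qed

lemma not_critical: "\<not> critical V \<theta> F \<sigma>"
proof
  assume crit: "critical V \<theta> F \<sigma>"
  interpret cosigned_family V F \<sigma> using criticalD(1)[OF crit] .
  have inj: "inj_on \<theta> V" by (rule criticalD(2)[OF crit])
  have "F \<noteq> {}"
  proof
    assume "F = {}"
    then have "coverable V \<theta> F \<sigma>" unfolding coverable_def outer_planar_iff by (intro exI[of _ "{}"]) auto
    then show False using criticalD(4)[OF crit] by simp
  qed
  then obtain U where U: "U \<in> F" by blast
  obtain a where a: "a \<in> V" "\<sigma> a = Minus" using minus_outside_union[OF U U] not_V[OF U] by auto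
  obtain b where b: "b \<in> V" "\<sigma> b = Plus" using plus_in_inter[OF U U] nonempty[OF U] by auto
  obtain m p where mp: "neighbours V \<theta> m p" "\<sigma> m = Minus" "\<sigma> p = Plus"
    using exists_opposite_neighbours[OF finite_V inj a b] .
  consider "tight_pair V F \<sigma> m p" | "tight_pair V ((-) V ` F) (flip \<circ> \<sigma>) p m"
    using critical_neighbours[OF crit mp] by blast
  then show False
  proof cases
    case 1
    then show False using critical_no_tight_pair[OF crit mp] by blast
  next
    case 2
    show False
      by (rule critical_no_tight_pair[OF critical_dual[OF crit] neighbours_commute[OF inj mp(1)] _ _ 2])
        (use mp in auto)
  qed
qed

lemma interval_instance_coverable:
  "interval_instance V \<theta> F \<sigma> \<Longrightarrow> coverable V \<theta> F \<sigma>"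
proof (induction "card V" arbitrary: V \<theta> F \<sigma> rule: less_induct)
  case less
  then show ?case using not_critical[of V \<theta> F \<sigma>] unfolding critical_def by blast
qed

section \<open>Circular intervals\<close>

text \<open>
  Cut open at the starting point of the interval, the interval becomes an initial segment.
\<close>

lemma circular_interval_chord_convex:
  assumes "finite V" "inj_on \<theta> V" "circular_interval V \<theta> U"
  shows "chord_convex V \<theta> U"
proof -
  obtain a b where ab: "a \<in> V" "b \<in> V" "U = {v \<in> V. v = a \<or> v = b \<or> ccw \<theta> a v b}"
    using assms(3) unfolding circular_interval_def by (elim bexE) (rule that)
  have UV: "U \<subseteq> V" using ab(3) by auto
  obtain K where K: "\<forall>u\<in>V. \<forall>v\<in>V. \<theta> u - \<theta> v < K"
    using finite_spread_bound[OF assms(1), of \<theta>] by auto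
  define \<theta>' where "\<theta>' = rotate_to K \<theta> a"
  note inj = rotate_to_least(1)[OF K assms(2) ab(1), folded \<theta>'_def]
    and least = rotate_to_least(2)[OF K assms(2) ab(1), folded \<theta>'_def]
    and same = same_crossings_rotate_to[where \<theta> = \<theta>, OF K ab(1), folded \<theta>'_def]
  have mem: "v \<in> U \<longleftrightarrow> \<theta>' v \<le> \<theta>' b" if v: "v \<in> V" for v
  proof -
    have "ccw \<theta> a v b \<longleftrightarrow> ccw \<theta>' a v b"
      unfolding \<theta>'_def using rotate_to_ccw[OF K ab(1) ab(1) v ab(2)] by simp
    moreover have "\<theta>' v = \<theta>' b \<longleftrightarrow> v = b" using inj v ab(2) by (simp add: inj_on_eq_iff)
    moreover have "\<theta>' a \<le> \<theta>' b" using least[OF ab(2)] by (cases "b = a") auto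
    ultimately show ?thesis
      using v ab(3) least[OF v] by (cases "v = a") (auto simp: ccw_def order_less_le)
  qed
  have "\<not> chords_cross \<theta> x y c d" if "x \<in> U" "y \<in> U" "c \<in> V - U" "d \<in> V - U" for x y c d
  proof -
    have V: "x \<in> V" "y \<in> V" "c \<in> V" "d \<in> V" using that UV by auto
    then have "\<theta>' x \<le> \<theta>' b" "\<theta>' y \<le> \<theta>' b" "\<theta>' b < \<theta>' c" "\<theta>' b < \<theta>' d"
      using mem that by (auto simp: not_le)
    then have "\<not> chords_cross \<theta>' x y c d" unfolding chords_cross_iff_less[OF inj V] by auto
    then show ?thesis using same V unfolding same_crossings_def by simp
  qed
  then show ?thesis unfolding chord_convex_def by simp
qed

theorem theorem1p3:
  fixes V :: "'a set" and F :: "'a set set" and \<sigma> :: "'a \<Rightarrow> sign" and \<theta> :: "'a \<Rightarrow> real"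
  assumes "finite V"
    and "circular_placement V \<theta>"
    and "F \<subseteq> Pow V - {{}, V}"
    and "crossing_family V F"
    and "\<not> (\<exists>U\<in>F. V - U \<in> F)"
    and "inter_union_closed_cosigning V F \<sigma>"
    and "\<forall>U\<in>F. circular_interval V \<theta> U"
  shows "\<exists>E. E \<subseteq> V \<times> V \<and>
           outer_planar \<theta> E \<and>
           (\<forall>(m, p)\<in>E. \<sigma> m = Minus \<and> \<sigma> p = Plus) \<and>
           (\<forall>U\<in>F. \<exists>(m, p)\<in>E. m \<notin> U \<and> p \<in> U)"
proof -
  have "cosigned_family V F \<sigma>" using assms by unfold_locales
  moreover have inj: "inj_on \<theta> V" using assms(2) unfolding circular_placement_def by simp
  ultimately have "interval_instance V \<theta> F \<sigma>"
    unfolding interval_instance_def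
    using circular_interval_chord_convex[OF assms(1) inj] assms(7) by simp
  then show ?thesis using interval_instance_coverable unfolding coverable_def by simp
qed

end
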